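(* Let $(W,S)$ be a Coxeter system with $S$ finite. Let $\mathbf s$ and $\mathbf s'$ be finite sequences from $S$ of lengths $n$ and $n'$, respectively, with $\mathbf s$ a proper subsequence of $\mathbf s'$. Let $\mathbf C=(C_1,C_2,\dots)$ be a Bernoulli$(1/2)$ process, and write $\mathbf C_k=(C_1,\dots,C_k)$. Then $$\mathbf E\bigl[|\xi(\mathbf s',\mathbf C_{n'})|\bigr]\ \ge\ \mathbf E\bigl[|\xi(\mathbf s,\mathbf C_n)|\bigr].$$
   Context: A Coxeter system $(W,S)$ is a group $W$ with generating set $S$ given by a presentation $\langle S\mid (ss')^{m(s,s')}\ \forall s,s'\in S\rangle$ where each $m(s,s')=m(s',s)$ is a positive integer or $\infty$ (no relation if $\infty$), $m(s,s)=1$, and $m(s,s')\ge 2$ for $s\ne s'$. $|w|$ is the word length of $w$ with respect to $S$. A Bernoulli$(1/2)$ process is a sequence of independent uniform $\{0,1\}$-valued random variables. For $s\in S$, $\xi(s,0)$ is the identity and $\xi(s,1):=s$. For $\mathbf s=(s_1,\dots,s_n)\in S^n$ and $\mathbf b=(b_1,\dots,b_n)\in\{0,1\}^n$, $\xi(\mathbf s,\mathbf b):=\xi(s_1,b_1)\xi(s_2,b_2)\cdots\xi(s_n,b_n)\in W$. A subsequence need not consist of consecutive terms. *)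

theory Defs
  imports "HOL-Probability.Probability" "HOL-Algebra.Algebra" "HOL-Library.Extended_Nat"
    "HOL-Library.Sublist"
begin

definition list_prod :: "('a, 'c) monoid_scheme \<Rightarrow> 'a list \<Rightarrow> 'a" where
  "list_prod G xs = foldr (\<lambda>x y. x \<otimes>\<^bsub>G\<^esub> y) xs \<one>\<^bsub>G\<^esub>"

(* Elements of the free group on a set S are represented by words in signed letters:
   (s, True) stands for s and (s, False) for the formal inverse of s. *)
type_synonym 'a signed_word = "('a \<times> bool) list"

definition signed_letter_val :: "('a, 'c) monoid_scheme \<Rightarrow> 'a \<times> bool \<Rightarrow> 'a" where
  "signed_letter_val G l = (if snd l then fst l else inv\<^bsub>G\<^esub> (fst l))"

definition signed_word_val :: "('a, 'c) monoid_scheme \<Rightarrow> 'a signed_word \<Rightarrow> 'a" where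
  "signed_word_val G w = list_prod G (map (signed_letter_val G) w)"

inductive pres_step :: "'a set \<Rightarrow> 'a signed_word set \<Rightarrow> 'a signed_word \<Rightarrow> 'a signed_word \<Rightarrow> bool"
  for S R where
  cancel: "s \<in> S \<Longrightarrow> pres_step S R (u @ [(s, b), (s, \<not> b)] @ v) (u @ v)"
| relator: "r \<in> R \<Longrightarrow> pres_step S R (u @ r @ v) (u @ v)"

(* G is presented by <S | R>, where S is a subset of G: G is generated by S, and a signed word
   over S evaluates to the identity iff it is trivial in the free group on S modulo the normal
   closure of R, i.e. iff it can be turned into the empty word by inserting and deleting
   cancelling pairs and relators. *)
definition presented_by :: "('a, 'c) monoid_scheme \<Rightarrow> 'a set \<Rightarrow> 'a signed_word set \<Rightarrow> bool" where
  "presented_by G S R \<longleftrightarrow>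
     S \<subseteq> carrier G \<and> R \<subseteq> lists (S \<times> UNIV) \<and> generate G S = carrier G \<and>
     (\<forall>w \<in> lists (S \<times> UNIV).
        signed_word_val G w = \<one>\<^bsub>G\<^esub> \<longleftrightarrow> equivclp (pres_step S R) w [])"

definition coxeter_relators :: "'a set \<Rightarrow> ('a \<Rightarrow> 'a \<Rightarrow> enat) \<Rightarrow> 'a signed_word set" where
  "coxeter_relators S m =
     {concat (replicate k [(s, True), (t, True)]) | s t k. s \<in> S \<and> t \<in> S \<and> m s t = enat k}"

locale coxeter_system = group G for G :: "('a, 'c) monoid_scheme" (structure) +
  fixes S :: "'a set" and m :: "'a \<Rightarrow> 'a \<Rightarrow> enat"
  assumes m_sym: "\<lbrakk>s \<in> S; t \<in> S\<rbrakk> \<Longrightarrow> m s t = m t s"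
    and m_diag: "s \<in> S \<Longrightarrow> m s s = 1"
    and m_off_diag: "\<lbrakk>s \<in> S; t \<in> S; s \<noteq> t\<rbrakk> \<Longrightarrow> m s t \<ge> 2"
    and presentation: "presented_by G S (coxeter_relators S m)"

(* The generators of a Coxeter group are involutions, so words in S alone suffice. *)
definition word_length :: "('a, 'c) monoid_scheme \<Rightarrow> 'a set \<Rightarrow> 'a \<Rightarrow> nat" where
  "word_length G S w = (LEAST n. \<exists>xs \<in> lists S. length xs = n \<and> list_prod G xs = w)"

(* The bits 0 and 1 are False and True. *)
definition xi_letter :: "('a, 'c) monoid_scheme \<Rightarrow> 'a \<Rightarrow> bool \<Rightarrow> 'a" where
  "xi_letter G s b = (if b then s else \<one>\<^bsub>G\<^esub>)"

(* Only meaningful for lists of equal length. *)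
definition xi :: "('a, 'c) monoid_scheme \<Rightarrow> 'a list \<Rightarrow> bool list \<Rightarrow> 'a" where
  "xi G ss bs = list_prod G (map2 (xi_letter G) ss bs)"

(* Indexed from 0: the process C_1, C_2, ... is C 0, C 1, ... *)
definition bernoulli_half_process :: "'w measure \<Rightarrow> (nat \<Rightarrow> 'w \<Rightarrow> bool) \<Rightarrow> bool" where
  "bernoulli_half_process M C \<longleftrightarrow>
     prob_space M \<and>
     prob_space.indep_vars M (\<lambda>_. count_space UNIV) C UNIV \<and>
     (\<forall>i. distr M (count_space UNIV) (C i) = measure_pmf (pmf_of_set UNIV))"

definition initial_bits :: "(nat \<Rightarrow> 'w \<Rightarrow> bool) \<Rightarrow> nat \<Rightarrow> 'w \<Rightarrow> bool list" where
  "initial_bits C k \<omega> = map (\<lambda>i. C i \<omega>) [0..<k]"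

end

theory Submission
  imports Defs
begin

text \<open>
  It suffices to insert one letter \<open>s\<close>, turning \<open>\<xi>(u) \<xi>(v)\<close> into \<open>\<xi>(u) s\<^sup>b \<xi>(v)\<close>, and so to show
  \<open>E|X s Y| \<ge> E|X Y|\<close> for the independent lazy products \<open>X = \<xi>(u)\<close> and \<open>Y = \<xi>(v)\<close>. Put \<open>A = X\<inverse>\<close>,
  which is the lazy product along the reversed word, and \<open>h(a, y) = |a\<inverse> s y| - |a\<inverse> y|\<close>. The wall
  of \<open>s\<close> splits \<open>W\<close> into a half-space \<open>D\<close> containing the identity and \<open>s D\<close>. Folding a geodesic
  along the wall gives \<open>h \<ge> 0\<close> on \<open>D \<times> D\<close>, and \<open>h\<close> changes sign when either argument is multiplied
  by \<open>s\<close> from the left. Any function with \<open>h(s y) = - h(y)\<close> and \<open>h \<ge> 0\<close> on \<open>D\<close> has nonnegative mean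
  along a lazy walk from the identity: this class is stable under
  \<open>h(y) \<mapsto> (h(y) + h(y t)) / 2\<close>, because a step \<open>y \<mapsto> y t\<close> leaving \<open>D\<close> satisfies \<open>y t = s y\<close>.
\<close>

lemma (in monoid) list_prod_Nil [simp]: "list_prod G [] = \<one>"
  by (simp add: list_prod_def)

lemma (in monoid) list_prod_Cons [simp]: "list_prod G (x # xs) = x \<otimes> list_prod G xs"
  by (simp add: list_prod_def)

lemma (in monoid) list_prod_closed [simp]:
  "xs \<in> lists (carrier G) \<Longrightarrow> list_prod G xs \<in> carrier G"
  by (induction xs) auto

lemma (in monoid) list_prod_append:
  "xs \<in> lists (carrier G) \<Longrightarrow> ys \<in> lists (carrier G) \<Longrightarrow>
     list_prod G (xs @ ys) = list_prod G xs \<otimes> list_prod G ys"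
  by (induction xs) (auto simp: m_assoc)

lemma (in monoid) list_prod_alternating:
  assumes "a \<in> carrier G" "b \<in> carrier G"
  shows "list_prod G (concat (replicate k [a, b])) = (a \<otimes> b) [^] k"
proof (induction k)
  case (Suc k)
  have "(a \<otimes> b) [^] Suc k = (a \<otimes> b) \<otimes> (a \<otimes> b) [^] k"
    using assms by (intro nat_pow_Suc2) auto
  with Suc show ?case using assms by (simp add: m_assoc)
qed simp

section \<open>Half-spaces of a Coxeter group\<close>

text \<open>Follows a path in the Cayley graph together with the parity of the number of crossings of the
  wall of \<open>s\<close>; an edge \<open>{g, g t}\<close> crosses it iff \<open>g t = s g\<close>. Letters outside \<open>S\<close> are skipped,
  which makes the invariance under arbitrary rewriting steps unconditional.\<close>

definition (in monoid) wall_step :: "'a set \<Rightarrow> 'a \<Rightarrow> 'a \<times> bool \<Rightarrow> 'a \<Rightarrow> 'a \<times> bool" where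
  "wall_step S s p t =
     (if t \<in> S then (fst p \<otimes> t, snd p \<noteq> (fst p \<otimes> t = s \<otimes> fst p)) else p)"

section \<open>Words and relations in the generators\<close>

context coxeter_system
begin

lemma S_subset: "S \<subseteq> carrier G"
  using presentation by (simp add: presented_by_def)

lemma S_closed [simp]: "s \<in> S \<Longrightarrow> s \<in> carrier G"
  using S_subset by blast

lemma lists_S_closed [simp]: "xs \<in> lists S \<Longrightarrow> xs \<in> lists (carrier G)"
  using S_subset by auto

lemma relator_pow:
  assumes "a \<in> S" "b \<in> S" "m a b = enat k"
  shows "(a \<otimes> b) [^] k = \<one>"
proof -
  let ?r = "concat (replicate k [(a, True), (b, True)])"
  have r: "?r \<in> coxeter_relators S m"
    using assms by (auto simp: coxeter_relators_def)
  have "pres_step S (coxeter_relators S m) ([] @ ?r @ []) ([] @ [])"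
    by (rule pres_step.relator[OF r])
  hence "equivclp (pres_step S (coxeter_relators S m)) ?r []"
    by (auto intro: r_into_equivclp)
  moreover have "?r \<in> lists (S \<times> UNIV)"
    using r presentation by (auto simp: presented_by_def)
  ultimately have "signed_word_val G ?r = \<one>"
    using presentation unfolding presented_by_def by blast
  moreover have "map (signed_letter_val G) ?r = concat (replicate k [a, b])"
    by (simp add: map_concat signed_letter_val_def)
  ultimately show ?thesis
    using assms by (simp add: signed_word_val_def list_prod_alternating)
qed

lemma S_involution [simp]: "s \<in> S \<Longrightarrow> s \<otimes> s = \<one>"
  using relator_pow[of s s 1] m_diag[of s] by (simp add: one_enat_def)

lemma S_inv [simp]: "s \<in> S \<Longrightarrow> inv s = s"
  by (simp add: inv_equality)

lemma S_cancel_left [simp]: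
  "s \<in> S \<Longrightarrow> g \<in> carrier G \<Longrightarrow> s \<otimes> (s \<otimes> g) = g"
  by (simp flip: m_assoc)

lemma S_cancel_right [simp]:
  "s \<in> S \<Longrightarrow> g \<in> carrier G \<Longrightarrow> g \<otimes> s \<otimes> s = g"
  by (simp add: m_assoc)

lemma word_exists:
  assumes "g \<in> carrier G"
  shows "\<exists>xs \<in> lists S. list_prod G xs = g"
proof -
  have "g \<in> generate G S" using assms presentation by (simp add: presented_by_def)
  thus ?thesis
  proof (induction rule: generate.induct)
    case one
    show ?case by (rule bexI[of _ "[]"]) auto
  next
    case (incl h)
    thus ?case by (intro bexI[of _ "[h]"]) auto
  next
    case (inv h)
    thus ?case by (intro bexI[of _ "[h]"]) auto
  next
    case (eng h1 h2)
    then obtain xs ys where "xs \<in> lists S" "ys \<in> lists S"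
      "list_prod G xs = h1" "list_prod G ys = h2" by blast
    thus ?case by (intro bexI[of _ "xs @ ys"]) (auto simp: list_prod_append simp del: in_lists_conv_set)
  qed
qed

section \<open>Parity of wall crossings along paths\<close>

abbreviation cross :: "'a \<Rightarrow> 'a \<times> bool \<Rightarrow> 'a list \<Rightarrow> 'a \<times> bool" where
  "cross s \<equiv> foldl (wall_step S s)"

lemma fst_cross:
  "xs \<in> lists S \<Longrightarrow> fst p \<in> carrier G \<Longrightarrow> fst (cross s p xs) = fst p \<otimes> list_prod G xs"
  by (induction xs arbitrary: p) (auto simp: wall_step_def m_assoc simp del: in_lists_conv_set)

lemma cross_closed: "fst p \<in> carrier G \<Longrightarrow> fst (cross s p xs) \<in> carrier G"
  by (induction xs arbitrary: p) (auto simp: wall_step_def)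

text \<open>Going along an edge and back toggles the flag twice or not at all, since
  \<open>g t = s g\<close> iff \<open>g = s (g t)\<close>.\<close>

lemma cross_pair:
  assumes "s \<in> S" "t \<in> S" "fst p \<in> carrier G"
  shows "cross s p [t, t] = p"
proof -
  have "fst p = s \<otimes> (fst p \<otimes> t) \<longleftrightarrow> fst p \<otimes> t = s \<otimes> fst p"
    using assms by (metis S_cancel_left m_closed S_closed)
  thus ?thesis using assms by (cases p) (auto simp: wall_step_def)
qed

text \<open>Conjugation by the involution \<open>a\<close> inverts \<open>a b\<close>, so the two
  powers cancel across \<open>a\<close>.\<close>

lemma alternating_conj:
  assumes "a \<in> S" "b \<in> S"
  shows "(a \<otimes> b) [^] (i::nat) \<otimes> a \<otimes> (a \<otimes> b) [^] i = a"
proof (induction i)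
  case (Suc i)
  let ?d = "a \<otimes> b"
  have "?d [^] Suc i = ?d \<otimes> ?d [^] i" using assms by (intro nat_pow_Suc2) auto
  hence "?d [^] Suc i \<otimes> a \<otimes> ?d [^] Suc i = ?d [^] i \<otimes> ?d \<otimes> a \<otimes> (?d \<otimes> ?d [^] i)"
    by simp
  also have "\<dots> = ?d [^] i \<otimes> (?d \<otimes> a \<otimes> ?d) \<otimes> ?d [^] i"
    using assms by (simp add: m_assoc)
  also have "?d \<otimes> a \<otimes> ?d = a" using assms by (simp add: m_assoc)
  finally show ?case using Suc by simp
qed (use assms in simp)

text \<open>The \<open>j\<close>-th edge of the path \<open>g, g a, g a b, \<dots>\<close> belongs to the reflection
  \<open>g (a b)\<^sup>j a g\<inverse>\<close>, which is periodic in \<open>j\<close> with period the order of \<open>a b\<close>.\<close>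

lemma cross_alternating:
  assumes "s \<in> S" "a \<in> S" "b \<in> S" "g \<in> carrier G"
  defines "Q \<equiv> \<lambda>j::nat. g \<otimes> (a \<otimes> b) [^] j \<otimes> a = s \<otimes> g"
  shows "cross s (g, c) (concat (replicate i [a, b])) =
    (g \<otimes> (a \<otimes> b) [^] i, c \<noteq> odd (\<Sum>j<2*i. of_bool (Q j) :: nat))"
proof (induction i)
  case (Suc i)
  let ?d = "a \<otimes> b" and ?e = "(a \<otimes> b) [^] i"
  have cl [simp]: "a \<in> carrier G" "b \<in> carrier G" "s \<in> carrier G" "?e \<in> carrier G"
    using assms by auto
  have dd: "?d [^] (2 * i) = ?e \<otimes> ?e"
    by (simp add: nat_pow_mult mult_2)
  have dd': "?d [^] Suc (2 * i) = ?e \<otimes> ?d \<otimes> ?e"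
    using nat_pow_mult[of ?d "Suc i" i] by (simp add: mult_2)
  have conj: "?e \<otimes> a \<otimes> ?e = a"
    by (rule alternating_conj[OF assms(2,3)])
  \<comment> \<open>Right multiplication by \<open>?e\<close> turns the reflection condition into
    the crossing condition at the vertex \<open>g \<otimes> ?e\<close>; for the odd edge below the
    multiplier is \<open>?e \<otimes> a\<close>.\<close>
  have "Q (2 * i) \<longleftrightarrow> (g \<otimes> (?e \<otimes> ?e) \<otimes> a) \<otimes> ?e = (s \<otimes> g) \<otimes> ?e"
    unfolding Q_def dd using assms by (subst right_cancel) auto
  also have "(g \<otimes> (?e \<otimes> ?e) \<otimes> a) \<otimes> ?e = g \<otimes> ?e \<otimes> (?e \<otimes> a \<otimes> ?e)"
    using assms by (simp add: m_assoc)
  finally have 1: "Q (2 * i) \<longleftrightarrow> g \<otimes> ?e \<otimes> a = s \<otimes> (g \<otimes> ?e)"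
    using assms unfolding conj by (simp add: m_assoc)
  have "Q (Suc (2 * i)) \<longleftrightarrow> (g \<otimes> (?e \<otimes> ?d \<otimes> ?e) \<otimes> a) \<otimes> (?e \<otimes> a) = (s \<otimes> g) \<otimes> (?e \<otimes> a)"
    unfolding Q_def dd' using assms by (subst right_cancel) auto
  also have "(g \<otimes> (?e \<otimes> ?d \<otimes> ?e) \<otimes> a) \<otimes> (?e \<otimes> a) = g \<otimes> ?e \<otimes> ?d \<otimes> (?e \<otimes> a \<otimes> ?e) \<otimes> a"
    using assms by (simp add: m_assoc)
  finally have 2: "Q (Suc (2 * i)) \<longleftrightarrow> g \<otimes> ?e \<otimes> a \<otimes> b = s \<otimes> (g \<otimes> ?e \<otimes> a)"
    using assms unfolding conj by (simp add: m_assoc)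
  have "concat (replicate (Suc i) [a, b]) = concat (replicate i [a, b]) @ [a, b]"
    by (induction i) auto
  hence "cross s (g, c) (concat (replicate (Suc i) [a, b])) =
      wall_step S s (wall_step S s (g \<otimes> ?e, c \<noteq> odd (\<Sum>j<2*i. of_bool (Q j) :: nat)) a) b"
    by (simp only: foldl_append Suc foldl_Cons foldl_Nil)
  also have "\<dots> = (g \<otimes> ?e \<otimes> a \<otimes> b,
      ((c \<noteq> odd (\<Sum>j<2*i. of_bool (Q j) :: nat)) \<noteq> Q (2 * i)) \<noteq> Q (Suc (2 * i)))"
    unfolding 1 2 wall_step_def using assms(2,3) by (simp only: fst_conv snd_conv if_True)
  also have "g \<otimes> ?e \<otimes> a \<otimes> b = g \<otimes> ?d [^] Suc i"
    using assms by (simp add: m_assoc)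
  also have "(((c \<noteq> odd (\<Sum>j<2*i. of_bool (Q j) :: nat)) \<noteq> Q (2 * i)) \<noteq> Q (Suc (2 * i))) =
      (c \<noteq> odd (\<Sum>j<2 * Suc i. of_bool (Q j) :: nat))"
    by (cases "Q (2 * i)"; cases "Q (Suc (2 * i))") (simp_all del: sum_of_bool_eq)
  finally show ?case .
qed (use assms in simp)

text \<open>The closed path around a relator has \<open>2 k\<close> edges, and \<open>Q\<close> has
  period \<open>k\<close> because \<open>a b\<close> has trivial \<open>k\<close>-th power, so the
  crossings come in pairs.\<close>

lemma cross_relator:
  assumes "s \<in> S" "a \<in> S" "b \<in> S" "fst p \<in> carrier G" "m a b = enat k"
  shows "cross s p (concat (replicate k [a, b])) = p"
proof -
  define Q :: "nat \<Rightarrow> bool" where "Q = (\<lambda>j. fst p \<otimes> (a \<otimes> b) [^] j \<otimes> a = s \<otimes> fst p)"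
  have d: "(a \<otimes> b) [^] k = \<one>" using assms relator_pow by blast
  have period: "Q (k + j) = Q j" for j
    using assms by (simp add: Q_def d flip: nat_pow_mult)
  have "(\<Sum>j<k+l. of_bool (Q j) :: nat) = (\<Sum>j<k. of_bool (Q j)) + (\<Sum>j<l. of_bool (Q (k + j)))" for l
    by (induction l) (simp_all del: sum_of_bool_eq)
  from this[of k] have "even (\<Sum>j<2*k. of_bool (Q j) :: nat)"
    unfolding mult_2 period by presburger
  thus ?thesis
    using cross_alternating[OF assms(1,2,3,4), of "snd p" k] assms(4) by (simp add: d Q_def)
qed

text \<open>Each rewriting step removes a closed piece that fixes the state reached after its
  prefix. Signs may be dropped because generators are involutions.\<close>

lemma cross_equiv:
  assumes "s \<in> S" "equivclp (pres_step S (coxeter_relators S m)) x y" "fst p \<in> carrier G"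
  shows "cross s p (map fst x) = cross s p (map fst y)"
  using assms(2)
proof (induction rule: equivclp_induct)
  case (step y z)
  have inv: "cross s p (map fst u) = cross s p (map fst v)"
    if "pres_step S (coxeter_relators S m) u v" for u v
    using that
  proof cases
    case (cancel t u' c v')
    thus ?thesis
      using cross_pair[OF assms(1) cancel(3) cross_closed[OF assms(3)], of s "map fst u'"] by simp
  next
    case (relator r u' v')
    then obtain a b k where r: "r = concat (replicate k [(a, True), (b, True)])"
      "a \<in> S" "b \<in> S" "m a b = enat k" by (auto simp: coxeter_relators_def)
    have "map fst r = concat (replicate k [a, b])" by (simp add: r map_concat)
    thus ?thesis
      using cross_relator[OF assms(1) r(2,3) cross_closed[OF assms(3)] r(4), of s "map fst u'"] relator
      by simp
  qed
  show ?case using step inv by metis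
qed simp

lemma cross_rev:
  assumes "s \<in> S" "xs \<in> lists S" "fst p \<in> carrier G"
  shows "cross s p (xs @ rev xs) = p"
  using assms(2,3)
proof (induction xs arbitrary: p rule: list.induct)
  case (Cons t xs)
  have "cross s p ((t # xs) @ rev (t # xs)) =
      wall_step S s (cross s (wall_step S s p t) (xs @ rev xs)) t" by simp
  also have "\<dots> = cross s p [t, t]"
    using Cons cross_closed[OF Cons.prems(2), of s "[t]"] by simp
  finally show ?case using cross_pair[of s t p] assms(1) Cons.prems by simp
qed simp

text \<open>Makes the crossing parity a function of the group element. The loop
  \<open>xs @ rev ys\<close> has product one, so by the presentation it rewrites to the empty word
  and restores the initial state; appending \<open>ys\<close> retraces
  \<open>rev ys\<close>.\<close>

lemma cross_unique:
  assumes "s \<in> S" "xs \<in> lists S" "ys \<in> lists S" "list_prod G xs = list_prod G ys"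
  shows "cross s (\<one>, c) xs = cross s (\<one>, c) ys"
proof -
  let ?w = "xs @ rev ys" and ?sg = "map (\<lambda>s. (s, True))"
  have rev: "rev ys \<in> lists S" using assms(3) by auto
  have "list_prod G (ys @ rev ys) = \<one>"
    using fst_cross[of "ys @ rev ys" "(\<one>, c)" s] cross_rev[of s ys "(\<one>, c)"] assms rev by simp
  hence "list_prod G ?w = \<one>"
    using assms rev by (simp add: list_prod_append del: in_lists_conv_set)
  hence "signed_word_val G (?sg ?w) = \<one>"
    by (simp add: signed_word_val_def signed_letter_val_def comp_def)
  moreover have "?sg ?w \<in> lists (S \<times> UNIV)" using assms by auto
  ultimately have eq: "equivclp (pres_step S (coxeter_relators S m)) (?sg ?w) []"
    using presentation unfolding presented_by_def by blast
  have "cross s (\<one>, c) xs = cross s (cross s (\<one>, c) xs) (rev ys @ rev (rev ys))"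
    using cross_rev[OF assms(1) rev] cross_closed[of "(\<one>, c)" s xs] by simp
  also have "\<dots> = cross s (cross s (\<one>, c) ?w) ys" by simp
  also have "cross s (\<one>, c) ?w = (\<one>, c)"
    using cross_equiv[OF assms(1) eq, of "(\<one>, c)"] by (simp add: comp_def)
  finally show ?thesis .
qed

text \<open>Left multiplication by \<open>s\<close> carries edges to edges and preserves whether
  they cross the wall, so both paths toggle their flags together.\<close>

lemma cross_reflect:
  assumes "s \<in> S" "fst p \<in> carrier G"
  shows "cross s (s \<otimes> fst p, \<not> snd p) xs =
    (s \<otimes> fst (cross s p xs), \<not> snd (cross s p xs))"
  using assms(2)
proof (induction xs arbitrary: p rule: list.induct)
  case (Cons t xs)
  have "s \<otimes> (fst p \<otimes> t) = fst p \<longleftrightarrow> fst p \<otimes> t = s \<otimes> fst p" if "t \<in> S"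
    using that assms Cons.prems by (metis S_cancel_left m_closed S_closed)
  hence "wall_step S s (s \<otimes> fst p, \<not> snd p) t =
      (s \<otimes> fst (wall_step S s p t), \<not> snd (wall_step S s p t))"
    using assms Cons.prems by (auto simp: wall_step_def m_assoc)
  thus ?case using Cons.IH[of "wall_step S s p t"] cross_closed[OF Cons.prems, of s "[t]"] by simp
qed simp

section \<open>The two sides of a wall\<close>

definition half_space :: "'a \<Rightarrow> 'a set" where
  "half_space s = {list_prod G xs | xs. xs \<in> lists S \<and> \<not> snd (cross s (\<one>, False) xs)}"

lemma half_space_iff:
  assumes "s \<in> S" "xs \<in> lists S"
  shows "list_prod G xs \<in> half_space s \<longleftrightarrow> \<not> snd (cross s (\<one>, False) xs)"
proof
  assume "list_prod G xs \<in> half_space s"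
  then obtain ys where ys: "ys \<in> lists S" "list_prod G ys = list_prod G xs"
    "\<not> snd (cross s (\<one>, False) ys)" unfolding half_space_def by fastforce
  thus "\<not> snd (cross s (\<one>, False) xs)" using cross_unique[OF assms(1) ys(1) assms(2) ys(2)] by simp
qed (use assms(2) in \<open>unfold half_space_def, blast\<close>)

lemma one_in_half_space: "s \<in> S \<Longrightarrow> \<one> \<in> half_space s"
  using half_space_iff[of s "[]"] by simp

text \<open>The word \<open>s # xs\<close> crosses the wall with its first edge, from
  \<open>\<one>\<close> to \<open>s\<close>, and then follows the mirror image of the path
  \<open>xs\<close>.\<close>

lemma half_space_reflect:
  assumes "s \<in> S" "w \<in> carrier G"
  shows "s \<otimes> w \<in> half_space s \<longleftrightarrow> w \<notin> half_space s"
proof -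
  obtain xs where xs: "xs \<in> lists S" "list_prod G xs = w" using word_exists assms by blast
  have "cross s (\<one>, False) (s # xs) = cross s (s \<otimes> \<one>, \<not> False) xs"
    using assms by (simp add: wall_step_def)
  hence "snd (cross s (\<one>, False) (s # xs)) = (\<not> snd (cross s (\<one>, False) xs))"
    using cross_reflect[OF assms(1), of "(\<one>, False)" xs] by simp
  thus ?thesis
    using half_space_iff[OF assms(1) xs(1)] half_space_iff[OF assms(1), of "s # xs"] assms xs by simp
qed

lemma half_space_exit:
  assumes "s \<in> S" "t \<in> S" "w \<in> carrier G" "w \<in> half_space s" "w \<otimes> t \<notin> half_space s"
  shows "w \<otimes> t = s \<otimes> w"
proof -
  obtain xs where xs: "xs \<in> lists S" "list_prod G xs = w" using word_exists assms by blast
  have wt: "list_prod G (xs @ [t]) = w \<otimes> t"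
    using xs assms by (subst list_prod_append) auto
  have "fst (cross s (\<one>, False) xs) = w" using fst_cross[OF xs(1), of "(\<one>, False)" s] xs assms by simp
  thus ?thesis
    using half_space_iff[OF assms(1) xs(1)] half_space_iff[OF assms(1), of "xs @ [t]"] assms xs wt
    by (auto simp: wall_step_def)
qed

section \<open>Folding\<close>

lemma word_length_le: "xs \<in> lists S \<Longrightarrow> word_length G S (list_prod G xs) \<le> length xs"
  unfolding word_length_def by (rule Least_le) blast

lemma reduced_word:
  assumes "w \<in> carrier G"
  obtains xs where "xs \<in> lists S" "length xs = word_length G S w" "list_prod G xs = w"
proof -
  have "\<exists>n. \<exists>xs \<in> lists S. length xs = n \<and> list_prod G xs = w" using word_exists[OF assms] by blast
  hence "\<exists>xs \<in> lists S. length xs = word_length G S w \<and> list_prod G xs = w"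
    unfolding word_length_def by (rule LeastI_ex)
  thus ?thesis using that by blast
qed

text \<open>The part of the path after its first crossing is reflected. It keeps its letters, while
  the crossing edge collapses: \<open>a t = s a\<close> lets the letter \<open>t\<close> be
  dropped.\<close>

lemma fold_path:
  assumes "s \<in> S" "xs \<in> lists S" "a \<in> carrier G"
    "a \<in> half_space s" "a \<otimes> list_prod G xs \<notin> half_space s"
  shows "\<exists>ys \<in> lists S. length ys \<le> length xs \<and> a \<otimes> list_prod G ys = s \<otimes> (a \<otimes> list_prod G xs)"
  using assms(2-5)
proof (induction xs arbitrary: a rule: list.induct)
  case (Cons t xs)
  have t: "t \<in> S" "xs \<in> lists S" "list_prod G xs \<in> carrier G" using Cons.prems by auto
  show ?case
  proof (cases "a \<otimes> t \<in> half_space s")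
    case True
    then obtain ys where ys: "ys \<in> lists S" "length ys \<le> length xs"
      "a \<otimes> t \<otimes> list_prod G ys = s \<otimes> (a \<otimes> t \<otimes> list_prod G xs)"
      using Cons.IH[of "a \<otimes> t"] Cons.prems t by (auto simp: m_assoc simp del: in_lists_conv_set)
    thus ?thesis using t Cons.prems assms(1)
      by (intro bexI[of _ "t # ys"]) (auto simp: m_assoc simp del: in_lists_conv_set)
  next
    case False
    hence "a \<otimes> t = s \<otimes> a" using half_space_exit assms(1) Cons.prems t by blast
    hence "s \<otimes> (a \<otimes> list_prod G (t # xs)) = a \<otimes> list_prod G xs"
      using Cons.prems t assms(1)
      by (metis S_cancel_left S_closed list_prod_Cons m_assoc m_closed)
    thus ?thesis using t by (intro bexI[of _ xs]) auto
  qed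
qed simp

text \<open>A geodesic from \<open>a\<close> to \<open>s y\<close> has to leave the half-space;
  folding it gives a path from \<open>a\<close> to \<open>y\<close> that is no longer.\<close>

lemma word_length_fold:
  assumes "s \<in> S" "a \<in> carrier G" "y \<in> carrier G" "a \<in> half_space s" "y \<in> half_space s"
  shows "word_length G S (inv a \<otimes> y) \<le> word_length G S (inv a \<otimes> (s \<otimes> y))"
proof -
  have s: "s \<in> carrier G" using assms by simp
  obtain xs where xs: "xs \<in> lists S" "length xs = word_length G S (inv a \<otimes> (s \<otimes> y))"
    "list_prod G xs = inv a \<otimes> (s \<otimes> y)"
    using reduced_word[of "inv a \<otimes> (s \<otimes> y)"] assms s by auto
  have endpoint: "a \<otimes> list_prod G xs = s \<otimes> y"
    using assms s by (simp add: xs(3) inv_solve_left flip: m_assoc)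
  obtain ys where ys: "ys \<in> lists S" "length ys \<le> length xs" "a \<otimes> list_prod G ys = s \<otimes> (s \<otimes> y)"
    using fold_path[OF assms(1) xs(1) assms(2,4)] half_space_reflect[of s y] assms endpoint by auto
  have "list_prod G ys = inv a \<otimes> y"
    using ys assms s by (simp add: inv_solve_left' [symmetric] inv_solve_left del: in_lists_conv_set)
  thus ?thesis using word_length_le[OF ys(1)] ys(2) xs(2) by simp
qed

end

section \<open>Means along lazy walks\<close>

text \<open>The expectation of \<open>f\<close> at the lazy product, by conditioning on the first
  bit. The recursion keeps the combinatorial argument free of measure theory.\<close>

fun (in monoid) walk_mean :: "'a list \<Rightarrow> ('a \<Rightarrow> real) \<Rightarrow> real" where
  "walk_mean [] f = f \<one>"
| "walk_mean (s # ss) f = (walk_mean ss f + walk_mean ss (\<lambda>y. f (s \<otimes> y))) / 2"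

context monoid
begin

lemma walk_mean_mono:
  assumes "ss \<in> lists (carrier G)" "\<And>y. y \<in> carrier G \<Longrightarrow> f y \<le> g y"
  shows "walk_mean ss f \<le> walk_mean ss g"
  using assms
proof (induction ss arbitrary: f g rule: list.induct)
  case (Cons s ss)
  have "walk_mean ss f \<le> walk_mean ss g"
    "walk_mean ss (\<lambda>y. f (s \<otimes> y)) \<le> walk_mean ss (\<lambda>y. g (s \<otimes> y))"
    using Cons.prems by (auto intro!: Cons.IH)
  thus ?case by simp
qed simp

lemma walk_mean_cong:
  assumes "ss \<in> lists (carrier G)" "\<And>y. y \<in> carrier G \<Longrightarrow> f y = g y"
  shows "walk_mean ss f = walk_mean ss g"
  using walk_mean_mono[OF assms(1), of f g] walk_mean_mono[OF assms(1), of g f] assms(2) by force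

lemma walk_mean_diff: "walk_mean ss (\<lambda>y. f y - g y) = walk_mean ss f - walk_mean ss g"
  by (induction ss arbitrary: f g) (simp_all add: add_divide_distrib diff_divide_distrib)

lemma walk_mean_minus: "walk_mean ss (\<lambda>y. - f y) = - walk_mean ss f"
  by (induction ss arbitrary: f) (auto simp: field_simps)

lemma walk_mean_half_sum:
  "walk_mean ss (\<lambda>y. (f y + g y) / 2) = (walk_mean ss f + walk_mean ss g) / 2"
  by (induction ss arbitrary: f g) (simp_all add: add_divide_distrib diff_divide_distrib)

lemma walk_mean_append:
  assumes "us \<in> lists (carrier G)" "vs \<in> lists (carrier G)"
  shows "walk_mean (us @ vs) f = walk_mean us (\<lambda>x. walk_mean vs (\<lambda>y. f (x \<otimes> y)))"
  using assms(1)
proof (induction us arbitrary: f rule: list.induct)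
  case Nil
  show ?case by (simp, rule walk_mean_cong) (use assms in auto)
next
  case (Cons u us)
  have "walk_mean us (\<lambda>x. walk_mean vs (\<lambda>y. f (u \<otimes> (x \<otimes> y)))) =
      walk_mean us (\<lambda>x. walk_mean vs (\<lambda>y. f (u \<otimes> x \<otimes> y)))"
    using Cons.prems assms(2) by (auto intro!: walk_mean_cong simp: m_assoc simp del: in_lists_conv_set)
  with Cons show ?case by simp
qed

lemma walk_mean_snoc:
  assumes "ss \<in> lists (carrier G)" "t \<in> carrier G"
  shows "walk_mean (ss @ [t]) f = walk_mean ss (\<lambda>x. (f x + f (x \<otimes> t)) / 2)"
  using assms by (subst walk_mean_append) (auto intro!: walk_mean_cong)

lemma xi_closed:
  assumes "ss \<in> lists (carrier G)"
  shows "xi G ss bs \<in> carrier G"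
  unfolding xi_def using assms
  by (intro list_prod_closed) (auto simp: xi_letter_def elim!: in_set_zipE)

text \<open>Unrolling the recursion meets every bit list of the right length once, with equal
  weights.\<close>

lemma walk_mean_eq_bit_average:
  assumes "ss \<in> lists (carrier G)"
  shows "walk_mean ss f = (\<Sum>bs | length bs = length ss. f (xi G ss bs)) / 2 ^ length ss"
  using assms
proof (induction ss arbitrary: f rule: list.induct)
  case Nil
  have "{bs :: bool list. length bs = 0} = {[]}" by auto
  thus ?case by (simp add: xi_def)
next
  case (Cons s ss)
  let ?B = "{bs :: bool list. length bs = length ss}"
  have fin: "finite ?B" using finite_lists_length_eq[of "UNIV :: bool set"] by simp
  have split: "{bs :: bool list. length bs = length (s # ss)} = (#) False ` ?B \<union> (#) True ` ?B"
  proof (intro Set.set_eqI iffI)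
    fix bs :: "bool list"
    assume "bs \<in> {bs. length bs = length (s # ss)}"
    then obtain b bs' where "bs = b # bs'" "length bs' = length ss" by (cases bs) auto
    thus "bs \<in> (#) False ` ?B \<union> (#) True ` ?B" by (cases b) auto
  qed auto
  have "(\<Sum>bs | length bs = length (s # ss). f (xi G (s # ss) bs)) =
      (\<Sum>bs\<in>?B. f (xi G (s # ss) (False # bs))) + (\<Sum>bs\<in>?B. f (xi G (s # ss) (True # bs)))"
    unfolding split using fin
    by (subst sum.union_disjoint) (auto simp: sum.reindex)
  moreover have "xi G (s # ss) (False # bs) = xi G ss bs"
    "xi G (s # ss) (True # bs) = s \<otimes> xi G ss bs" for bs
    using xi_closed[of ss bs] Cons.prems by (auto simp: xi_def xi_letter_def)
  ultimately show ?case
    using Cons.IH[of f] Cons.IH[of "\<lambda>y. f (s \<otimes> y)"] Cons.prems by (simp add: add_divide_distrib)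
qed

end

text \<open>Inversion reverses a product, so the first letter of \<open>ss\<close> becomes the last
  letter of the new word.\<close>

lemma (in group) walk_mean_inv:
  assumes "ss \<in> lists (carrier G)"
  shows "walk_mean ss (\<lambda>x. f (inv x)) = walk_mean (rev (map (\<lambda>x. inv x) ss)) f"
  using assms
proof (induction ss arbitrary: f rule: list.induct)
  case (Cons s ss)
  have "walk_mean ss (\<lambda>y. f (inv (s \<otimes> y))) = walk_mean ss (\<lambda>y. f (inv y \<otimes> inv s))"
    using Cons.prems by (intro walk_mean_cong) (auto simp: inv_mult_group)
  moreover have "rev (map (\<lambda>x. inv x) ss) \<in> lists (carrier G)" using Cons.prems by auto
  ultimately show ?case
    using Cons.prems Cons.IH[of f] Cons.IH[of "\<lambda>z. f (z \<otimes> inv s)"]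
    by (simp add: walk_mean_snoc walk_mean_half_sum del: in_lists_conv_set)
qed simp

section \<open>Odd functions along lazy walks, and insertion of letters\<close>

context coxeter_system
begin

text \<open>The last step is absorbed into \<open>h\<close> by averaging. Oddness survives because
  left multiplication by \<open>s\<close> commutes with right multiplication by
  \<open>t\<close>.\<close>

lemma walk_mean_odd_nonneg:
  assumes "s \<in> S" "ss \<in> lists S"
    "\<And>y. y \<in> carrier G \<Longrightarrow> h (s \<otimes> y) = - h y"
    "\<And>y. y \<in> carrier G \<Longrightarrow> y \<in> half_space s \<Longrightarrow> h y \<ge> 0"
  shows "walk_mean ss h \<ge> 0"
  using assms(2-4)
proof (induction ss arbitrary: h rule: rev_induct)
  case Nil
  thus ?case using one_in_half_space assms(1) by simp
next
  case (snoc t ss)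
  have t: "t \<in> S" "ss \<in> lists S" using snoc.prems(1) by auto
  have "0 \<le> walk_mean ss (\<lambda>y. (h y + h (y \<otimes> t)) / 2)"
  proof (rule snoc.IH)
    fix y assume y: "y \<in> carrier G"
    show "(h (s \<otimes> y) + h (s \<otimes> y \<otimes> t)) / 2 = - ((h y + h (y \<otimes> t)) / 2)"
      using snoc.prems(2)[OF y] snoc.prems(2)[of "y \<otimes> t"] y t assms(1)
      by (simp add: m_assoc field_simps)
    assume D: "y \<in> half_space s"
    show "0 \<le> (h y + h (y \<otimes> t)) / 2"
    proof (cases "y \<otimes> t \<in> half_space s")
      case True
      thus ?thesis using snoc.prems(3) y D t by simp
    next
      case False
      \<comment> \<open>The step crosses the wall, so by oddness the two terms cancel.\<close>
      hence "y \<otimes> t = s \<otimes> y" using half_space_exit assms(1) t y D by blast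
      thus ?thesis using snoc.prems(2)[OF y] by simp
    qed
  qed (fact t)
  thus ?case using t by (simp add: walk_mean_snoc del: in_lists_conv_set)
qed

text \<open>\<open>walk_mean_odd_nonneg\<close> is applied twice: to the walk along
  \<open>vs\<close> for fixed \<open>a\<close> in the half-space, then to the walk of
  \<open>a\<close> along \<open>rev us\<close>, with the first mean as its function.\<close>

lemma walk_mean_insert:
  assumes "s \<in> S" "us \<in> lists S" "vs \<in> lists S"
  defines "L \<equiv> \<lambda>w. real (word_length G S w)"
  shows "walk_mean (us @ vs) L \<le> walk_mean (us @ s # vs) L"
proof -
  have s: "s \<in> carrier G" using assms by simp
  \<comment> \<open>The change in length caused by a forced \<open>s\<close>. Writing the left
    factor as \<open>inv a\<close> makes both arguments move by right multiplication.\<close>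
  define h where "h = (\<lambda>a y. L (inv a \<otimes> (s \<otimes> y)) - L (inv a \<otimes> y))"
  have inv_sa: "inv (s \<otimes> a) = inv a \<otimes> s" if "a \<in> carrier G" for a
    using that assms(1) by (simp add: inv_mult_group)
  have odd2: "h a (s \<otimes> y) = - h a y" if "y \<in> carrier G" for a y
    using that assms(1) by (simp add: h_def)
  have odd1: "h (s \<otimes> a) y = - h a y" if "a \<in> carrier G" "y \<in> carrier G" for a y
    using that assms(1) by (simp add: h_def inv_sa m_assoc)
  have "0 \<le> walk_mean (rev us) (\<lambda>a. walk_mean vs (h a))"
  proof (rule walk_mean_odd_nonneg[OF assms(1)])
    show "rev us \<in> lists S" using assms(2) by auto
    fix a assume a: "a \<in> carrier G"
    show "walk_mean vs (h (s \<otimes> a)) = - walk_mean vs (h a)"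
      unfolding walk_mean_minus[symmetric]
      using assms(3) odd1[OF a] by (intro walk_mean_cong) (auto simp del: in_lists_conv_set)
    assume "a \<in> half_space s"
    thus "0 \<le> walk_mean vs (h a)"
      using word_length_fold[OF assms(1) a] odd2
      by (intro walk_mean_odd_nonneg[OF assms(1,3)]) (auto simp: h_def L_def)
  qed
  also have "rev us = rev (map (\<lambda>x. inv x) us)"
    using assms(2) by (auto intro!: map_idI[symmetric])
  also have "walk_mean \<dots> (\<lambda>a. walk_mean vs (h a)) = walk_mean us (\<lambda>x. walk_mean vs (h (inv x)))"
    using assms(2) walk_mean_inv[of us "\<lambda>a. walk_mean vs (h a)"] by (simp del: in_lists_conv_set)
  also have "\<dots> = walk_mean us (\<lambda>x. walk_mean vs (\<lambda>y. L (x \<otimes> (s \<otimes> y))) - walk_mean vs (\<lambda>y. L (x \<otimes> y)))"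
    using assms(2) by (intro walk_mean_cong) (auto simp: h_def walk_mean_diff simp del: in_lists_conv_set)
  also have "\<dots> = walk_mean us (\<lambda>x. walk_mean vs (\<lambda>y. L (x \<otimes> (s \<otimes> y)))) - walk_mean (us @ vs) L"
    using assms by (simp add: walk_mean_diff walk_mean_append del: in_lists_conv_set)
  finally have "walk_mean (us @ vs) L \<le> walk_mean us (\<lambda>x. walk_mean vs (\<lambda>y. L (x \<otimes> (s \<otimes> y))))"
    by simp
  \<comment> \<open>The new bit omits or uses \<open>s\<close> with weight one half each.\<close>
  moreover have "walk_mean (us @ s # vs) L =
      (walk_mean (us @ vs) L + walk_mean us (\<lambda>x. walk_mean vs (\<lambda>y. L (x \<otimes> (s \<otimes> y))))) / 2"
    using walk_mean_append[of us "s # vs" L] walk_mean_append[of us vs L] assms s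
    by (simp add: walk_mean_half_sum del: in_lists_conv_set)
  ultimately show ?thesis by simp
qed

text \<open>The prefix \<open>us\<close> is arbitrary so that a head shared by both lists can move
  into it; an unmatched head is an insertion.\<close>

lemma walk_mean_subseq:
  assumes "subseq xs ys" "us \<in> lists S" "ys \<in> lists S"
  defines "L \<equiv> \<lambda>w. real (word_length G S w)"
  shows "walk_mean (us @ xs) L \<le> walk_mean (us @ ys) L"
  using assms(1-3)
proof (induction arbitrary: us rule: list_emb.induct)
  case (list_emb_Nil ys)
  thus ?case
  proof (induction ys)
    case (Cons y ys)
    hence "walk_mean (us @ ys) L \<le> walk_mean (us @ y # ys) L"
      unfolding L_def by (intro walk_mean_insert) auto
    with Cons show ?case by simp
  qed simp
next
  case (list_emb_Cons xs ys y)
  hence "walk_mean (us @ ys) L \<le> walk_mean (us @ y # ys) L"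
    unfolding L_def by (intro walk_mean_insert) auto
  with list_emb_Cons show ?case by fastforce
next
  case (list_emb_Cons2 x y xs ys)
  thus ?case using list_emb_Cons2.IH[of "us @ [x]"] by simp
qed

end

section \<open>The Bernoulli process\<close>

lemma prob_initial_bits:
  assumes "bernoulli_half_process M C"
  shows "initial_bits C n -` {bs} \<inter> space M \<in> sets M"
    and "length bs = n \<Longrightarrow> measure M (initial_bits C n -` {bs} \<inter> space M) = 1 / 2 ^ n"
proof -
  interpret prob_space M using assms by (simp add: bernoulli_half_process_def)
  have indep: "indep_vars (\<lambda>_. count_space UNIV) C UNIV"
    and dist: "distr M (count_space UNIV) (C i) = measure_pmf (pmf_of_set UNIV)" for i
    using assms by (auto simp: bernoulli_half_process_def)
  have meas [measurable]: "C i \<in> measurable M (count_space UNIV)" for i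
    using indep by (simp add: indep_vars_def)
  have pr: "prob (C i -` {b} \<inter> space M) = 1 / 2" for i b
  proof -
    have "prob (C i -` {b} \<inter> space M) = measure (distr M (count_space UNIV) (C i)) {b}"
      by (simp add: measure_distr meas)
    also have "\<dots> = 1 / 2" by (simp add: dist measure_pmf_single pmf_of_set)
    finally show ?thesis .
  qed
  have eq: "initial_bits C n -` {bs} \<inter> space M = {\<omega> \<in> space M. \<forall>i<n. C i \<omega> = bs ! i}"
    if "length bs = n"
  proof -
    have "initial_bits C n \<omega> = bs \<longleftrightarrow> (\<forall>i<n. C i \<omega> = bs ! i)" for \<omega>
      by (subst list_eq_iff_nth_eq) (simp add: initial_bits_def that)
    thus ?thesis by blast
  qed
  show "initial_bits C n -` {bs} \<inter> space M \<in> sets M"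
  proof (cases "length bs = n")
    case True
    show ?thesis unfolding eq[OF True] by measurable
  next
    case False
    hence "initial_bits C n -` {bs} = {}" by (auto simp: initial_bits_def)
    thus ?thesis by simp
  qed
  assume len: "length bs = n"
  show "prob (initial_bits C n -` {bs} \<inter> space M) = 1 / 2 ^ n"
  \<comment> \<open>For \<open>n = 0\<close> the intersection below would have an empty index set
    and be \<open>UNIV\<close> instead of \<open>space M\<close>.\<close>
  proof (cases "n = 0")
    case True
    thus ?thesis using len eq prob_space by simp
  next
    case False
    have "initial_bits C n -` {bs} \<inter> space M = (\<Inter>i\<in>{..<n}. C i -` {bs ! i} \<inter> space M)"
      using False by (auto simp: eq[OF len])
    also have "prob \<dots> = (\<Prod>i\<in>{..<n}. prob (C i -` {bs ! i} \<inter> space M))"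
      using False by (intro indep_varsD[OF indep]) auto
    finally show ?thesis by (simp add: pr power_one_over)
  qed
qed

text \<open>Only finitely many bit lists occur, so the integrand is a finite combination of
  indicators of the events computed above.\<close>

lemma expectation_initial_bits:
  fixes f :: "bool list \<Rightarrow> real"
  assumes "bernoulli_half_process M C"
  shows "prob_space.expectation M (\<lambda>\<omega>. f (initial_bits C n \<omega>)) = (\<Sum>bs | length bs = n. f bs) / 2 ^ n"
proof -
  interpret prob_space M using assms by (simp add: bernoulli_half_process_def)
  let ?B = "{bs :: bool list. length bs = n}"
  let ?A = "\<lambda>bs. initial_bits C n -` {bs} \<inter> space M"
  have fin: "finite ?B" using finite_lists_length_eq[of "UNIV :: bool set"] by simp
  have "f (initial_bits C n \<omega>) = (\<Sum>bs\<in>?B. f bs * indicator (?A bs) \<omega>)" if "\<omega> \<in> space M" for \<omega>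
  proof -
    have "(\<Sum>bs\<in>?B. f bs * indicator (?A bs) \<omega>) =
        (\<Sum>bs\<in>?B. if bs = initial_bits C n \<omega> then f bs else 0)"
      using that by (intro sum.cong) (auto simp: indicator_def)
    thus ?thesis using fin by (simp add: initial_bits_def)
  qed
  hence "expectation (\<lambda>\<omega>. f (initial_bits C n \<omega>)) =
      expectation (\<lambda>\<omega>. \<Sum>bs\<in>?B. f bs * indicator (?A bs) \<omega>)"
    by (intro Bochner_Integration.integral_cong) auto
  also have "\<dots> = (\<Sum>bs\<in>?B. f bs * prob (?A bs))"
    using prob_initial_bits(1)[OF assms]
    by (subst Bochner_Integration.integral_sum)
      (auto intro!: integrable_mult_right simp: emeasure_eq_measure)
  also have "\<dots> = (\<Sum>bs\<in>?B. f bs) / 2 ^ n"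
    unfolding sum_divide_distrib by (intro sum.cong) (auto simp: prob_initial_bits(2)[OF assms])
  finally show ?thesis .
qed

theorem theorem2p21:
  fixes G :: "('a, 'c) monoid_scheme"
    and S :: "'a set"
    and m :: "'a \<Rightarrow> 'a \<Rightarrow> enat"
    and ss ss' :: "'a list"
    and n n' :: nat
    and M :: "'w measure"
    and C :: "nat \<Rightarrow> 'w \<Rightarrow> bool"
  assumes "coxeter_system G S m"
    and "finite S"
    and "ss \<in> lists S" and "length ss = n"
    and "ss' \<in> lists S" and "length ss' = n'"
    and "strict_subseq ss ss'"
    and "bernoulli_half_process M C"
  shows "prob_space.expectation M (\<lambda>\<omega>. real (word_length G S (xi G ss' (initial_bits C n' \<omega>))))
       \<ge> prob_space.expectation M (\<lambda>\<omega>. real (word_length G S (xi G ss (initial_bits C n \<omega>))))"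
proof -
  interpret coxeter_system G S m by fact
  \<comment> \<open>Each expectation depends only on the law of its own block of bits, so the two
    can be compared as walk means.\<close>
  have mean: "prob_space.expectation M
        (\<lambda>\<omega>. real (word_length G S (xi G xs (initial_bits C (length xs) \<omega>)))) =
      walk_mean xs (\<lambda>w. real (word_length G S w))" if "xs \<in> lists S" for xs
    unfolding walk_mean_eq_bit_average[OF lists_S_closed[OF that]]
    by (rule expectation_initial_bits[OF assms(8), where f = "\<lambda>bs. real (word_length G S (xi G xs bs))"])
  have "subseq ss ss'" using assms(7) by (simp add: strict_subseq_def)
  from walk_mean_subseq[OF this, of "[]"] assms(5) show ?thesis
    unfolding assms(4,6)[symmetric] mean[OF assms(3)] mean[OF assms(5)] by simp
qed

end
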